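(* Let $\mathcal{S}\subseteq\mathbb{R}^n$ be a $d$-dimensional subspace, $r=n-d$, let $y_1,\dots,y_{m_1}\in\mathbb{R}^n$ (inliers) span $\mathcal{S}$, let $o_1,\dots,o_{m_2}\in\mathbb{R}^n$ (outliers), put $m=m_1+m_2$, and let $\widetilde y_1,\dots,\widetilde y_m$ be the inliers and outliers listed together in an arbitrary order. Let $f(X)=\frac1m\sum_{i=1}^m\|\widetilde y_i^\top X\|_2$ for $X\in\mathrm{St}(n,r)$. Let $S^\perp\in\mathrm{St}(n,r)$ be an orthonormal basis of $\mathcal{S}^\perp$ and $\mathcal{X}=\{S^\perp R: R\in\mathrm{St}(r,r)\}$. Suppose that $m_2c_{O,\max}<\frac12m_1c_{Y,\min}$. Then the problem of minimizing $f$ over $\mathrm{St}(n,r)$ has $\mathcal{X}$ as a set of weak sharp minima with parameter $\alpha=\frac1m\left(\frac12m_1c_{Y,\min}-m_2c_{O,\max}\right)>0$ over the set $\mathcal{B}=\mathrm{St}(n,r)$; i.e., $$f(X)-f(S^\perp)\ge\alpha\,\mathrm{dist}(X,\mathcal{X}),\qquad\forall\,X\in\mathrm{St}(n,r).$$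
   Context: $\mathrm{St}(n,r)=\{X\in\mathbb{R}^{n\times r}:X^\top X=I_r\}$ (so $\mathrm{St}(r,r)$ is the orthogonal group), $\|\cdot\|_F$ is the Frobenius norm, and $\mathrm{dist}(X,\mathcal{X})=\inf_{Y\in\mathcal{X}}\|X-Y\|_F$. With $\ell=\min\{d,r\}$ and $\mathrm{col}(D)$ the column space of $D$, $$c_{Y,\min}:=\frac1{m_1}\inf\Big\{\sum_{i=1}^{m_1}\|y_i^\top D\|_2:\ D\in\mathbb{R}^{n\times\ell},\ \|D\|_F=1,\ \mathrm{col}(D)\subseteq\mathcal{S}\Big\},$$ $$c_{O,\max}:=\frac1{m_2}\sup\Big\{\sum_{i=1}^{m_2}\|o_i^\top B\|_2:\ B\in\mathbb{R}^{n\times r},\ \|B\|_F=1\Big\}.$$ A set $\mathcal{X}\subseteq\mathrm{St}(n,r)$ is a set of weak sharp minima for $f$ with parameter $\alpha>0$ over $\mathcal{B}$ if $f(X)-f(Y)\ge\alpha\,\mathrm{dist}(X,\mathcal{X})$ for all $X\in\mathcal{B}$ and $Y\in\mathcal{X}$ (here $f$ is constant on $\mathcal{X}$, since $f(XR)=f(X)$ for $R\in\mathrm{St}(r,r)$). *)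

theory Defs
  imports "HOL-Analysis.Analysis" "HOL-Library.Multiset"
begin

text \<open>
  An \<open>n \<times> k\<close> matrix is a \<^typ>\<open>real^'k^'n\<close>. On this type \<^const>\<open>norm\<close> is the Frobenius norm and
  \<^const>\<open>infdist\<close> is the distance to a set in the Frobenius norm; \<open>v v* X\<close> is the row vector
  \<open>v\<^sup>T X\<close>.
\<close>

definition stiefel :: "(real^'r^'n) set" where
  "stiefel = {X. transpose X ** X = mat 1}"

definition col_space :: "real^'k^'n \<Rightarrow> (real^'n) set" where
  "col_space D = span (columns D)"

definition objective :: "(real^'n) list \<Rightarrow> real^'r^'n \<Rightarrow> real" where
  "objective zs X = 1 / real (length zs) * (\<Sum>z\<leftarrow>zs. norm (z v* X))"

text \<open>
  The type arguments fix the number of columns of the matrices ranged over. If \<open>S\<close> is the zero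
  space, the infimum is over the empty set and the value of \<open>c_Y_min\<close> is meaningless.
\<close>

definition c_Y_min :: "'l::finite itself \<Rightarrow> (real^'n) set \<Rightarrow> (real^'n) list \<Rightarrow> real" where
  "c_Y_min _ S ys = 1 / real (length ys) *
     (INF D \<in> {D :: real^'l^'n. norm D = 1 \<and> col_space D \<subseteq> S}. \<Sum>y\<leftarrow>ys. norm (y v* D))"

definition c_O_max :: "'r::finite itself \<Rightarrow> (real^'n) list \<Rightarrow> real" where
  "c_O_max _ os = 1 / real (length os) *
     (SUP B \<in> {B :: real^'r^'n. norm B = 1}. \<Sum>x\<leftarrow>os. norm (x v* B))"

definition weak_sharp_minima ::
  "(real^'r^'n \<Rightarrow> real) \<Rightarrow> (real^'r^'n) set \<Rightarrow> real \<Rightarrow> (real^'r^'n) set \<Rightarrow> bool" where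
  "weak_sharp_minima f \<X> \<alpha> \<B> \<longleftrightarrow>
     \<X> \<subseteq> stiefel \<and> \<alpha> > 0 \<and> (\<forall>X\<in>\<B>. \<forall>Y\<in>\<X>. f X - f Y \<ge> \<alpha> * infdist X \<X>)"

end

theory Submission
  imports Defs
begin

text \<open>
  Write \<open>B\<close> for the given orthonormal basis \<open>Sperp\<close> of \<open>S\<^sup>\<bottom>\<close> and, for \<open>X\<close> on the Stiefel manifold, let
  \<open>P = X - B B\<^sup>T X\<close>, whose columns are the orthogonal projections of the columns of \<open>X\<close> onto \<open>S\<close>.
  The norm \<open>p\<close> of \<open>P\<close> controls both what the inliers gain and what the outliers can lose.
  
  Geometry (\<open>stiefel_nearest_basis\<close>). Some orthogonal \<open>R\<close> satisfies \<open>\<parallel>X - B R\<parallel>\<^sup>2 \<le> 2 p\<^sup>2\<close>. Let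
  \<open>A = B\<^sup>T X\<close>, a contraction, and let \<open>R\<close> be its orthogonal polar factor, \<open>A = R C\<close> with \<open>C\<close> symmetric
  and positive semidefinite. Then \<open>\<parallel>X - B R\<parallel>\<^sup>2 = 2 (r - trace C)\<close> and \<open>p\<^sup>2 = r - trace (C\<^sup>2)\<close>, so
  the claim is \<open>trace (C\<^sup>2) \<le> trace C\<close>, which holds because \<open>0 \<le> C \<le> 1\<close>. In terms of the cosines
  \<open>\<sigma>\<close> of the principal angles this is the inequality \<open>\<sigma>\<^sup>2 \<le> \<sigma>\<close>.
  
  Inliers (\<open>inlier_growth\<close>). An inlier \<open>y\<close> satisfies \<open>y\<^sup>T X = y\<^sup>T P\<close>, and \<open>y\<^sup>T B R = 0\<close>. The rank of \<open>P\<close>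
  is at most \<open>\<ell> = min d r\<close>, so \<open>P\<close> can be compressed to \<open>\<ell>\<close> columns in \<open>S\<close> without changing any
  \<open>\<parallel>y\<^sup>T P\<parallel>\<close>; hence the inlier sum grows by at least \<open>m\<^sub>1 c\<^sub>Y p\<close> on the way from \<open>B R\<close> to \<open>X\<close>.
  
  Outliers (\<open>outlier_loss\<close>). By the triangle inequality the outlier sum drops by at most
  \<open>m\<^sub>2 c\<^sub>O t\<close>, where \<open>t = \<parallel>X - B R\<parallel>\<close>.
  
  The objective takes the same value at \<open>B R\<close> and at \<open>B\<close>. Since \<open>t \<le> 2 p\<close>, the objective therefore
  exceeds this value by at least \<open>(m\<^sub>1 c\<^sub>Y / 2 - m\<^sub>2 c\<^sub>O) t / m\<close>, and \<open>t\<close> is at least the distance from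
  \<open>X\<close> to the solution set.
\<close>

section \<open>The Frobenius inner product\<close>

lemma matrix_inner_eq_trace:
  fixes A B :: "real^'k^'m"
  shows "A \<bullet> B = trace (transpose A ** B)"
  unfolding inner_vec_def trace_def matrix_matrix_mult_def transpose_def
  by (simp add: sum.swap[of _ UNIV "UNIV::'k set"])

lemma matrix_inner_mult_left:
  fixes A :: "real^'k^'m"
  shows "(A ** B) \<bullet> C = B \<bullet> (transpose A ** C)"
  by (simp add: matrix_inner_eq_trace matrix_transpose_mul matrix_mul_assoc)

lemma matrix_inner_eq_sum_columns:
  fixes A :: "real^'k^'m"
  shows "A \<bullet> B = (\<Sum>i\<in>UNIV. (A *v axis i 1) \<bullet> (B *v axis i 1))"
proof -
  have "(A *v axis i 1) \<bullet> (B *v axis i 1) = (\<Sum>j\<in>UNIV. A$j$i * B$j$i)" for i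
    by (simp add: matrix_vector_mult_basis inner_vec_def column_def)
  then show ?thesis
    by (simp add: inner_vec_def sum.swap[of _ UNIV "UNIV::'k set"])
qed

lemma trace_eq_sum_axis:
  fixes A :: "real^'k^'k"
  shows "trace A = (\<Sum>i\<in>UNIV. axis i 1 \<bullet> (A *v axis i 1))"
  by (simp add: trace_def matrix_vector_mult_basis inner_axis' column_def)

lemma vector_matrix_linear: "linear (\<lambda>A::real^'k^'m. x v* A)"
  by (intro linearI)
    (vector vector_matrix_mult_def sum.distrib distrib_left sum_distrib_left algebra_simps)+

section \<open>Polar decomposition\<close>

text \<open>
  The Householder reflection in the hyperplane orthogonal to \<open>u\<close>. Dividing by \<open>u \<bullet> u\<close> allows vectors
  of any length; division by zero makes \<open>reflection 0\<close> the identity, which is orthogonal too.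
\<close>

definition reflection :: "real^'k \<Rightarrow> real^'k^'k" where
  "reflection u = mat 1 - (\<chi> i j. 2 / (u \<bullet> u) * (u$i * u$j))"

lemma reflection_mult_vec: "reflection u *v x = x - (2 * (u \<bullet> x) / (u \<bullet> u)) *\<^sub>R u"
proof -
  have "(\<chi> i j. 2 / (u \<bullet> u) * (u$i * u$j)) *v x = (2 * (u \<bullet> x) / (u \<bullet> u)) *\<^sub>R u"
    by (simp add: vec_eq_iff matrix_vector_mult_def inner_vec_def[of u x] sum_distrib_left
        sum_distrib_right sum_divide_distrib mult_ac)
  then show ?thesis
    by (simp add: reflection_def matrix_vector_mult_diff_rdistrib)
qed

lemma orthogonal_matrix_reflection: "orthogonal_matrix (reflection u)"
proof -
  have "norm (reflection u *v x) = norm x" for x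
  proof (cases "u = 0")
    case False
    then have "u \<bullet> u \<noteq> 0" by simp
    then have "(reflection u *v x) \<bullet> (reflection u *v x) = x \<bullet> x"
      by (simp add: reflection_mult_vec inner_diff_left inner_diff_right inner_commute[of x u])
    then show ?thesis by (simp add: norm_eq)
  qed (simp add: reflection_mult_vec)
  then have "orthogonal_transformation ((*v) (reflection u))"
    by (simp add: orthogonal_transformation)
  then show ?thesis
    by (simp add: orthogonal_transformation_matrix)
qed

lemma trace_reflection_mult:
  fixes C :: "real^'k^'k"
  shows "trace (reflection u ** C) = trace C - 2 * (u \<bullet> (C *v u)) / (u \<bullet> u)"
proof -
  have "u \<bullet> (C *v axis i 1) = (u v* C)$i" for i
    by (simp add: inner_axis flip: dot_lmul_matrix)
  then have *: "(\<Sum>i\<in>UNIV. u$i * (u \<bullet> (C *v axis i 1))) = u \<bullet> (C *v u)"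
    by (simp add: inner_vec_def[of "u v* C" u] mult.commute flip: dot_lmul_matrix)
  have "trace (reflection u ** C)
      = (\<Sum>i\<in>UNIV. axis i 1 \<bullet> (C *v axis i 1)
          - 2 / (u \<bullet> u) * (u$i * (u \<bullet> (C *v axis i 1))))"
    unfolding trace_eq_sum_axis
    by (simp add: reflection_mult_vec inner_diff_right inner_axis' mult_ac
        flip: matrix_vector_mul_assoc)
  also have "\<dots> = trace C - 2 / (u \<bullet> u) * (u \<bullet> (C *v u))"
    by (simp only: sum_subtractf trace_eq_sum_axis sum_distrib_left[symmetric] *)
  finally show ?thesis by simp
qed

text \<open>
  For small \<open>t\<close> of the sign of \<open>b\<close> the left-hand side would exceed the right-hand side. This replaces
  the derivative test at a maximum.
\<close>

lemma linear_le_quadratic_imp_zero: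
  fixes b K :: real
  assumes "\<And>t. t * b \<le> t\<^sup>2 * K"
  shows "b = 0"
proof -
  define s where "s = b / (\<bar>K\<bar> + 1)"
  have b: "b = s * (\<bar>K\<bar> + 1)" by (simp add: s_def)
  have "s * b \<le> s\<^sup>2 * K" by (rule assms)
  also have "\<dots> \<le> s\<^sup>2 * \<bar>K\<bar>" by (intro mult_left_mono) auto
  finally have "s\<^sup>2 \<le> 0" by (simp add: b power2_eq_square algebra_simps)
  then show ?thesis by (simp add: b)
qed

text \<open>
  Products of two reflections are the plane rotations. Rotating slightly in the plane of \<open>u\<close> and
  \<open>w\<close> changes the trace to first order by the antisymmetric part of \<open>C\<close> in this plane, which
  maximality forces to vanish.
\<close>

lemma symmetric_if_trace_maximal:
  fixes C :: "real^'k^'k"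
  assumes max: "\<And>Q. orthogonal_matrix Q \<Longrightarrow> trace (Q ** C) \<le> trace C"
  shows "u \<bullet> (C *v w) = w \<bullet> (C *v u)"
proof -
  \<comment> \<open>Maximality against \<open>reflection u ** reflection v\<close>, with the denominators cleared.\<close>
  have two: "2 * (u \<bullet> v) * (v \<bullet> (C *v u)) \<le> (v \<bullet> v) * (u \<bullet> (C *v u)) + (u \<bullet> u) * (v \<bullet> (C *v v))"
    for u v
  proof (cases "u = 0 \<or> v = 0")
    case False
    then have pos: "u \<bullet> u > 0" "v \<bullet> v > 0" by auto
    have "trace (reflection u ** (reflection v ** C)) \<le> trace C"
      unfolding matrix_mul_assoc
      by (intro max orthogonal_matrix_mul orthogonal_matrix_reflection)
    then have "2 * (u \<bullet> v) * (v \<bullet> (C *v u)) / ((u \<bullet> u) * (v \<bullet> v))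
        \<le> (u \<bullet> (C *v u)) / (u \<bullet> u) + (v \<bullet> (C *v v)) / (v \<bullet> v)"
      using pos by (simp add: trace_reflection_mult reflection_mult_vec inner_diff_right field_simps
          flip: matrix_vector_mul_assoc)
    then show ?thesis using pos by (simp add: field_simps)
  qed auto
  show ?thesis
  proof (cases "u = 0")
    case False
    \<comment> \<open>Take \<open>v = u + t w\<close>: the terms constant in \<open>t\<close> cancel, and \<open>K\<close> collects those in \<open>t\<^sup>2\<close>.\<close>
    define K where "K = (w \<bullet> w) * (u \<bullet> (C *v u)) + (u \<bullet> u) * (w \<bullet> (C *v w)) - 2 * (u \<bullet> w) * (w \<bullet> (C *v u))"
    have "t * ((u \<bullet> u) * (w \<bullet> (C *v u) - u \<bullet> (C *v w))) \<le> t\<^sup>2 * K" for t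
      using two[of u "u + t *\<^sub>R w"] unfolding K_def
      by (simp add: inner_add_left inner_add_right inner_commute[of w u] matrix_vector_right_distrib
          power2_eq_square algebra_simps)
    then show ?thesis
      using linear_le_quadratic_imp_zero False by fastforce
  qed auto
qed

lemma positive_if_trace_maximal:
  fixes C :: "real^'k^'k"
  assumes max: "\<And>Q. orthogonal_matrix Q \<Longrightarrow> trace (Q ** C) \<le> trace C"
  shows "u \<bullet> (C *v u) \<ge> 0"
proof (cases "u = 0")
  case False
  then have pos: "u \<bullet> u > 0" by auto
  have "0 \<le> (u \<bullet> (C *v u)) / (u \<bullet> u)"
    using max[OF orthogonal_matrix_reflection[of u]] by (simp add: trace_reflection_mult)
  with pos show ?thesis
    by (metis divide_neg_pos not_le)
qed auto

lemma compact_orthogonal_matrices: "compact {R :: real^'k^'k. orthogonal_matrix R}"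
proof -
  have "norm R = sqrt CARD('k)" if "orthogonal_matrix R" for R :: "real^'k^'k"
    using that by (simp add: orthogonal_matrix norm_eq_sqrt_inner matrix_inner_eq_trace trace_I)
  then have "bounded {R :: real^'k^'k. orthogonal_matrix R}"
    by (intro boundedI[where B = "sqrt CARD('k)"]) auto
  moreover have "closed {R :: real^'k^'k. orthogonal_matrix R}"
    unfolding orthogonal_matrix matrix_matrix_mult_def transpose_def
    by (intro closed_Collect_eq continuous_intros)
  ultimately show ?thesis by (simp add: compact_eq_bounded_closed)
qed

text \<open>
  The orthogonal factor is the point of the compact orthogonal group with the largest inner product
  with \<open>A\<close>. This variational choice avoids diagonalising \<open>A\<^sup>T A\<close>: that \<open>C = R\<^sup>T A\<close> is symmetric and
  positive semidefinite is exactly what reflections and products of two of them detect.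
\<close>

proposition polar_decomposition:
  fixes A :: "real^'k^'k"
  obtains R C where "orthogonal_matrix R" "A = R ** C"
    "\<And>u w. u \<bullet> (C *v w) = w \<bullet> (C *v u)" "\<And>u. u \<bullet> (C *v u) \<ge> 0"
proof -
  have "\<exists>R\<in>{R :: real^'k^'k. orthogonal_matrix R}. \<forall>Q\<in>{R. orthogonal_matrix R}. Q \<bullet> A \<le> R \<bullet> A"
    using orthogonal_matrix_id
    by (intro continuous_attains_sup compact_orthogonal_matrices continuous_intros) auto
  then obtain R :: "real^'k^'k" where R: "orthogonal_matrix R"
    and max: "\<And>Q. orthogonal_matrix Q \<Longrightarrow> Q \<bullet> A \<le> R \<bullet> A" by auto
  define C where "C = transpose R ** A"
  have "trace (Q ** C) \<le> trace C" if "orthogonal_matrix Q" for Q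
  proof -
    have "orthogonal_matrix (R ** transpose Q)"
      using R that by (intro orthogonal_matrix_mul) auto
    from max[OF this] show ?thesis
      by (simp add: C_def matrix_inner_eq_trace matrix_transpose_mul matrix_mul_assoc)
  qed
  moreover have "A = R ** C"
    using R by (simp add: C_def matrix_mul_assoc orthogonal_matrix_def)
  ultimately show thesis
    using that R symmetric_if_trace_maximal positive_if_trace_maximal by blast
qed

text \<open>
  For symmetric \<open>C\<close> with \<open>0 \<le> C \<le> 1\<close> this says \<open>C\<^sup>2 \<le> C\<close>. Instead of using eigenvalues, evaluate the
  form of \<open>C\<close> at \<open>u - C u\<close>, where it is nonnegative.
\<close>

lemma inner_square_le_inner_if_contraction:
  fixes C :: "real^'k^'k"
  assumes sym: "\<And>u w. u \<bullet> (C *v w) = w \<bullet> (C *v u)" and pos: "\<And>u. u \<bullet> (C *v u) \<ge> 0"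
    and contr: "\<And>u. norm (C *v u) \<le> norm u"
  shows "(C *v u) \<bullet> (C *v u) \<le> u \<bullet> (C *v u)"
proof -
  let ?w = "C *v u"
  have "?w \<bullet> (C *v ?w) \<le> norm ?w * norm (C *v ?w)" by (rule norm_cauchy_schwarz)
  also have "\<dots> \<le> norm ?w * norm ?w" by (intro mult_left_mono contr) auto
  finally have le: "?w \<bullet> (C *v ?w) \<le> ?w \<bullet> ?w"
    by (simp add: dot_square_norm power2_eq_square)
  have "0 \<le> (u - ?w) \<bullet> (C *v (u - ?w))" by (rule pos)
  also have "\<dots> = u \<bullet> ?w - 2 * (?w \<bullet> ?w) + ?w \<bullet> (C *v ?w)"
    using sym[of u ?w] by (simp add: inner_diff_left inner_diff_right matrix_vector_mult_diff_distrib)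
  finally show ?thesis using le by linarith
qed

corollary inner_self_le_trace_if_contraction:
  fixes C :: "real^'k^'k"
  assumes "\<And>u w. u \<bullet> (C *v w) = w \<bullet> (C *v u)" and "\<And>u. u \<bullet> (C *v u) \<ge> 0"
    and "\<And>u. norm (C *v u) \<le> norm u"
  shows "C \<bullet> C \<le> trace C"
  unfolding matrix_inner_eq_sum_columns trace_eq_sum_axis
  by (intro sum_mono inner_square_le_inner_if_contraction assms)

section \<open>The nearest basis in the solution set\<close>

lemma stiefel_iff_orthogonal_matrix: "R \<in> stiefel \<longleftrightarrow> orthogonal_matrix R"
  for R :: "real^'r^'r"
  by (simp add: stiefel_def orthogonal_matrix)

lemma stiefel_inner_mult:
  fixes X :: "real^'r^'n"
  assumes "X \<in> stiefel"
  shows "(X ** A) \<bullet> (X ** B) = A \<bullet> B"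
  using assms by (simp add: matrix_inner_mult_left matrix_mul_assoc stiefel_def)

lemma stiefel_inner_self:
  fixes X :: "real^'r^'n"
  assumes "X \<in> stiefel"
  shows "X \<bullet> X = CARD('r)"
  using assms by (simp add: matrix_inner_eq_trace stiefel_def trace_I)

lemma stiefel_norm_mult_vec:
  fixes X :: "real^'r^'n"
  assumes "X \<in> stiefel"
  shows "norm (X *v v) = norm v"
proof -
  have "(X *v v) \<bullet> (X *v v) = (v v* (transpose X ** X)) \<bullet> v"
    by (simp add: dot_lmul_matrix flip: vector_matrix_mul_assoc)
  then show ?thesis using assms by (simp add: stiefel_def norm_eq)
qed

lemma stiefel_norm_transpose_mult_vec:
  fixes X :: "real^'r^'n"
  assumes "X \<in> stiefel"
  shows "norm (transpose X *v w) \<le> norm w"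
proof -
  let ?v = "transpose X *v w"
  have "norm ?v * norm ?v = w \<bullet> (X *v ?v)"
    by (simp add: dot_lmul_matrix flip: power2_eq_square dot_square_norm)
  also have "\<dots> \<le> norm w * norm ?v"
    using norm_cauchy_schwarz[of w "X *v ?v"] by (simp add: stiefel_norm_mult_vec[OF assms])
  finally show ?thesis
    by (cases "norm ?v = 0") auto
qed

text \<open>
  Both squared distances are functions of the contraction \<open>A = B\<^sup>T X\<close>. They are \<open>2 (r - trace C)\<close> and
  \<open>r - C \<bullet> C\<close> when \<open>R\<close> and \<open>C\<close> are the polar factors of \<open>A\<close>, so that the bound reduces to
  \<open>C \<bullet> C \<le> trace C\<close>.
\<close>

proposition stiefel_nearest_basis:
  fixes X B :: "real^'r^'n"
  assumes X: "X \<in> stiefel" and B: "B \<in> stiefel"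
  obtains R where "R \<in> stiefel"
    "(norm (X - B ** R))\<^sup>2 \<le> 2 * (norm (X - B ** (transpose B ** X)))\<^sup>2"
proof -
  define A where "A = transpose B ** X"
  obtain R C where R: "orthogonal_matrix R" and AC: "A = R ** C"
    and C: "\<And>u w. u \<bullet> (C *v w) = w \<bullet> (C *v u)" "\<And>u. u \<bullet> (C *v u) \<ge> 0"
    using polar_decomposition[of A] by blast
  have R': "R \<in> stiefel" using R by (simp add: stiefel_iff_orthogonal_matrix)
  have "norm (C *v u) \<le> norm u" for u
  proof -
    have "norm (C *v u) = norm (transpose B *v (X *v u))"
      using stiefel_norm_mult_vec[OF R', of "C *v u"] AC A_def
      by (simp only: matrix_vector_mul_assoc)
    also have "\<dots> \<le> norm u"
      using stiefel_norm_transpose_mult_vec[OF B, of "X *v u"] stiefel_norm_mult_vec[OF X] by simp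
    finally show ?thesis .
  qed
  then have "C \<bullet> C \<le> trace C"
    by (intro inner_self_le_trace_if_contraction C)
  moreover have "A \<bullet> A = C \<bullet> C"
    by (simp add: AC stiefel_inner_mult[OF R'])
  moreover have "(B ** R) \<bullet> X = trace C"
  proof -
    have "(B ** R) \<bullet> X = R \<bullet> A"
      by (simp only: matrix_inner_mult_left A_def)
    also have "\<dots> = trace C"
      using R by (simp add: AC matrix_inner_eq_trace matrix_mul_assoc orthogonal_matrix)
    finally show ?thesis .
  qed
  ultimately have AA: "A \<bullet> A \<le> (B ** R) \<bullet> X" by simp
  have "(norm (X - B ** R))\<^sup>2 = 2 * (CARD('r) - (B ** R) \<bullet> X)"
    using stiefel_inner_self[OF X] stiefel_inner_self[OF R']
    by (simp add: power2_norm_eq_inner inner_diff_left inner_diff_right stiefel_inner_mult[OF B]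
        inner_commute[of X "B ** R"])
  also have "\<dots> \<le> 2 * (CARD('r) - A \<bullet> A)"
    using AA by simp
  also have "CARD('r) - A \<bullet> A = (norm (X - B ** A))\<^sup>2"
  proof -
    have "(B ** A) \<bullet> X = A \<bullet> A"
      by (simp only: matrix_inner_mult_left A_def)
    then show ?thesis
      using stiefel_inner_self[OF X]
      by (simp add: power2_norm_eq_inner inner_diff_left inner_diff_right stiefel_inner_mult[OF B]
          inner_commute[of X "B ** A"])
  qed
  finally show thesis
    using that[OF R'] by (simp add: A_def)
qed

section \<open>Compressing a matrix to as many columns as its rank\<close>

lemma norm_matrix_eq_if_rows:
  fixes P :: "real^'k^'n" and D :: "real^'l^'n"
  assumes "\<And>x. norm (x v* D) = norm (x v* P)"
  shows "norm D = norm P"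
proof -
  have row: "axis i 1 v* M = M $ i" for i and M :: "real^'m^'n"
    using matrix_vector_mult_basis[of "transpose M" i]
    by (simp add: row_def column_transpose vec_lambda_eta)
  show ?thesis
    using assms[of "axis _ 1"] unfolding row norm_vec_def[of D] norm_vec_def[of P]
    by simp
qed

text \<open>
  The columns of \<open>V\<close> are an orthonormal basis of the row space of \<open>P\<close>, padded with zero columns if the
  rank is smaller than the number of columns available. Every \<open>x\<^sup>T P\<close> lies in this row space, on
  which multiplication by \<open>V\<close> takes coordinates with respect to that basis and so preserves norms.
\<close>

lemma rank_compression:
  fixes P :: "real^'r^'n"
  assumes "rank P \<le> CARD('l::finite)"
  obtains V :: "real^'l^'r" where "\<And>x. norm (x v* (P ** V)) = norm (x v* P)"
proof -
  obtain B where B: "pairwise orthogonal B" "\<And>b. b \<in> B \<Longrightarrow> norm b = 1"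
    "independent B" "card B = dim (span (rows P))" "span B = span (rows P)"
    using orthonormal_basis_subspace[OF subspace_span] by metis
  have fin: "finite B" using B(3) by (rule independent_imp_finite)
  have "card B \<le> CARD('l)" using assms B(4) by (simp add: row_rank_def)
  then obtain g where g: "inj_on g B" "g ` B \<subseteq> (UNIV :: 'l set)"
    using inj_on_iff_card_le[OF fin finite] by blast
  define v where "v j = (if j \<in> g ` B then inv_into B g j else 0)" for j
  define V :: "real^'l^'r" where "V = (\<chi> i j. v j $ i)"
  have vg: "v (g b) = b" if "b \<in> B" for b
    using that g by (simp add: v_def)
  have "norm (w v* V) = norm w" if w: "w \<in> span B" for w
  proof -
    have "(w v* V) \<bullet> (w v* V) = (\<Sum>j\<in>UNIV. (w \<bullet> v j)\<^sup>2)"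
      by (simp add: inner_vec_def vector_matrix_mult_def V_def power2_eq_square mult.commute)
    also have "\<dots> = (\<Sum>j\<in>g ` B. (w \<bullet> v j)\<^sup>2)"
      by (intro sum.mono_neutral_right) (auto simp: v_def)
    also have "\<dots> = (\<Sum>b\<in>B. (w \<bullet> b)\<^sup>2)"
      using g by (simp add: sum.reindex vg)
    also have "\<dots> = w \<bullet> (\<Sum>b\<in>B. (w \<bullet> b) *\<^sub>R b)"
      by (simp add: inner_sum_right power2_eq_square)
    also have "\<dots> = w \<bullet> w"
      using orthonormal_basis_expand[OF B(1,2) w fin] by simp
    finally show ?thesis by (simp add: norm_eq)
  qed
  moreover have "x v* P \<in> span B" for x
  proof -
    have "x v* P = (\<Sum>i\<in>UNIV. x $ i *\<^sub>R row i P)"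
      by (simp add: vec_eq_iff vector_matrix_mult_def row_def mult.commute)
    also have "\<dots> \<in> span B"
      unfolding B(5) by (intro span_sum span_scale span_base) (auto simp: rows_def)
    finally show ?thesis .
  qed
  ultimately show thesis
    using that[of V] by (simp flip: vector_matrix_mul_assoc)
qed

section \<open>The constants as bounds for all matrices\<close>

lemma sum_list_norm_mult_scaleR:
  fixes D :: "real^'k^'n"
  shows "(\<Sum>y\<leftarrow>ys. norm (y v* (c *\<^sub>R D))) = \<bar>c\<bar> * (\<Sum>y\<leftarrow>ys. norm (y v* D))"
  by (simp add: linear_cmul[OF vector_matrix_linear] sum_list_const_mult)

lemma sum_list_norm_nonneg: "0 \<le> (\<Sum>y\<leftarrow>ys. norm (y v* (D :: real^'k^'n)))"
  by (intro sum_list_nonneg) auto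

text \<open>
  Homogeneity extends the bound from matrices of norm one to all matrices. If \<open>S\<close> is the zero space,
  so that the infimum is over the empty set, then \<open>D = 0\<close> and both sides are zero.
\<close>

lemma c_Y_min_bound:
  fixes D :: "real^'l^'n"
  assumes "col_space D \<subseteq> S"
  shows "real (length ys) * c_Y_min TYPE('l) S ys * norm D \<le> (\<Sum>y\<leftarrow>ys. norm (y v* D))"
proof (cases "D = 0 \<or> ys = []")
  case False
  define E where "E = D /\<^sub>R norm D"
  have "column i E = column i D /\<^sub>R norm D" for i
    by (simp add: column_def E_def vec_eq_iff)
  then have "columns E \<subseteq> span (columns D)"
    by (auto simp: columns_def intro!: span_scale intro: span_base)
  then have "col_space E \<subseteq> S"
    using assms span_minimal[OF _ subspace_span] unfolding col_space_def by blast
  moreover have "norm E = 1" using False by (simp add: E_def)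
  moreover have "bdd_below ((\<lambda>D. \<Sum>y\<leftarrow>ys. norm (y v* D)) ` {D :: real^'l^'n. norm D = 1 \<and> col_space D \<subseteq> S})"
    by (intro bdd_belowI2[where m = 0] sum_list_norm_nonneg)
  ultimately have "real (length ys) * c_Y_min TYPE('l) S ys \<le> (\<Sum>y\<leftarrow>ys. norm (y v* E))"
    using False unfolding c_Y_min_def by (auto intro!: cINF_lower)
  also have "\<dots> = (\<Sum>y\<leftarrow>ys. norm (y v* D)) / norm D"
    unfolding E_def sum_list_norm_mult_scaleR by (simp add: divide_inverse_commute)
  finally show ?thesis using False by (simp add: pos_le_divide_eq)
qed (auto simp: sum_list_norm_nonneg)

text \<open>
  The supremum is a true upper bound because a continuous function is bounded on the compact unit
  sphere.
\<close>

lemma c_O_max_bound: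
  fixes B :: "real^'r^'n"
  shows "(\<Sum>x\<leftarrow>os. norm (x v* B)) \<le> real (length os) * c_O_max TYPE('r) os * norm B"
proof (cases "B = 0 \<or> os = []")
  case False
  define E where "E = B /\<^sub>R norm B"
  have "norm E = 1" using False by (simp add: E_def)
  moreover have "continuous_on (sphere 0 1) (\<lambda>B :: real^'r^'n. \<Sum>x\<leftarrow>os. norm (x v* B))"
    by (induction os) (simp_all add: continuous_on_add continuous_on_norm linear_continuous_on
        vector_matrix_linear flip: linear_conv_bounded_linear)
  then have "bounded ((\<lambda>B. \<Sum>x\<leftarrow>os. norm (x v* B)) ` sphere (0 :: real^'r^'n) 1)"
    by (intro compact_imp_bounded compact_continuous_image compact_sphere)
  then have "bdd_above ((\<lambda>B. \<Sum>x\<leftarrow>os. norm (x v* B)) ` {B :: real^'r^'n. norm B = 1})"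
    by (simp add: bounded_imp_bdd_above sphere_def)
  ultimately have "(\<Sum>x\<leftarrow>os. norm (x v* E)) \<le> real (length os) * c_O_max TYPE('r) os"
    using False unfolding c_O_max_def by (auto intro!: cSUP_upper)
  moreover have "(\<Sum>x\<leftarrow>os. norm (x v* E)) = (\<Sum>x\<leftarrow>os. norm (x v* B)) / norm B"
    unfolding E_def sum_list_norm_mult_scaleR by (simp add: divide_inverse_commute)
  ultimately show ?thesis using False by (simp add: pos_divide_le_eq)
qed auto

lemma c_O_max_nonneg: "0 \<le> real (length os) * c_O_max TYPE('r::finite) (os :: (real^'n) list)"
proof -
  obtain B :: "real^'r^'n" where "norm B = 1"
    using vector_choose_size[of 1] by auto
  then show ?thesis
    using c_O_max_bound[where os = os and B = B] sum_list_norm_nonneg[where ys = os and D = B] by simp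
qed


section \<open>Growth over inliers and loss over outliers\<close>

lemma orthogonal_comp_col_space: "x \<in> orthogonal_comp (col_space B) \<longleftrightarrow> x v* B = 0"
proof -
  have coord: "(x v* B) $ j = column j B \<bullet> x" for j
    by (simp add: vector_matrix_mult_def inner_vec_def column_def mult.commute)
  have "x v* B = 0 \<longleftrightarrow> (\<forall>b\<in>columns B. orthogonal x b)"
    unfolding vec_eq_iff coord by (auto simp: columns_def orthogonal_def inner_commute)
  also have "\<dots> \<longleftrightarrow> x \<in> orthogonal_comp (col_space B)"
    unfolding orthogonal_comp_def col_space_def
    by (auto simp: orthogonal_commute[of _ x] intro: orthogonal_to_span span_base)
  finally show ?thesis by simp
qed

lemma column_matrix_mult: "column j (P ** V) = P *v column j V" for P :: "real^'k^'n"
  by (simp add: matrix_vector_mul_assoc flip: matrix_vector_mult_basis)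

lemma sum_list_map_mset_union:
  fixes f :: "'a \<Rightarrow> 'b::comm_monoid_add"
  assumes "mset zs = mset ys + mset os"
  shows "(\<Sum>z\<leftarrow>zs. f z) = (\<Sum>y\<leftarrow>ys. f y) + (\<Sum>x\<leftarrow>os. f x)"
  using arg_cong[OF assms, of "\<lambda>M. sum_mset (image_mset f M)"]
  by (simp add: sum_mset_sum_list flip: mset_map)

lemma norm_vec_mult_stiefel:
  fixes B :: "real^'r^'n" and R :: "real^'r^'r"
  assumes "R \<in> stiefel"
  shows "norm (z v* (B ** R)) = norm (z v* B)"
proof -
  have "transpose R \<in> stiefel"
    using assms by (simp add: stiefel_iff_orthogonal_matrix)
  from stiefel_norm_mult_vec[OF this, of "z v* B"] show ?thesis
    by (simp add: vector_matrix_mul_assoc)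
qed

lemma matrix_diff_ldistrib: "A ** (B - C) = A ** B - A ** C" for A :: "real^'k^'m"
  by (vector matrix_matrix_mult_def sum_subtractf right_diff_distrib)

text \<open>
  The constant \<open>c_Y_min\<close> speaks of matrices with \<open>min (dim S) r\<close> columns, while \<open>P = X - B B\<^sup>T X\<close> has
  \<open>r\<close> columns. As the columns of \<open>P\<close> lie in \<open>S\<close>, its rank permits the compression; for \<open>y\<close> in \<open>S\<close> the
  removed part \<open>y\<^sup>T B B\<^sup>T X\<close> vanishes.
\<close>

lemma inlier_growth:
  fixes X B :: "real^'r^'n" and S :: "(real^'n) set"
  assumes S: "subspace S" and dim: "CARD('l::finite) = min (dim S) CARD('r)"
    and B: "B \<in> stiefel" and BS: "col_space B = orthogonal_comp S" and ys: "set ys \<subseteq> S"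
  shows "real (length ys) * c_Y_min TYPE('l) S ys * norm (X - B ** (transpose B ** X))
      \<le> (\<Sum>y\<leftarrow>ys. norm (y v* X))"
proof -
  define P where "P = X - B ** (transpose B ** X)"
  \<comment> \<open>\<open>S\<close> is its own double orthogonal complement, hence the left kernel of \<open>B\<close>.\<close>
  have mem: "x \<in> S \<longleftrightarrow> x v* B = 0" for x
    using orthogonal_comp_col_space[of x B] by (simp add: BS orthogonal_comp_self[OF S])
  have "transpose B ** P = 0"
    using B by (simp add: P_def matrix_diff_ldistrib matrix_mul_assoc stiefel_def)
  then have "column i P v* B = 0" for i
    using column_matrix_mult[of i "transpose B" P] by (simp add: column_def flip: zero_vec_def)
  then have cols: "columns P \<subseteq> S" by (auto simp: columns_def mem)
  have "rank P \<le> CARD('l)"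
    using dim_subset[OF cols] rank_bound[of P] by (simp add: dim column_rank_def)
  then obtain V :: "real^'l^'r" where V: "\<And>x. norm (x v* (P ** V)) = norm (x v* P)"
    using rank_compression by blast
  have "columns (P ** V) \<subseteq> span (columns P)"
    by (auto simp: columns_def[of "P ** V"] column_matrix_mult matrix_vector_mult_in_columnspace)
  then have "col_space (P ** V) \<subseteq> S"
    using cols S unfolding col_space_def by (metis span_minimal subset_trans)
  then have "real (length ys) * c_Y_min TYPE('l) S ys * norm (P ** V) \<le> (\<Sum>y\<leftarrow>ys. norm (y v* (P ** V)))"
    by (rule c_Y_min_bound)
  also have "\<dots> = (\<Sum>y\<leftarrow>ys. norm (y v* X))"
  proof -
    have "y v* P = y v* X" if "y \<in> S" for y
    proof -
      have "y v* P = y v* X - (y v* B) v* (transpose B ** X)"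
        by (simp add: P_def vector_matrix_mult_diff_rdistrib vector_matrix_mul_assoc)
      with that show ?thesis by (simp add: mem)
    qed
    then show ?thesis
      using ys by (intro arg_cong[where f = sum_list] map_cong) (auto simp: V)
  qed
  finally show ?thesis
    using norm_matrix_eq_if_rows[OF V] by (simp add: P_def)
qed

lemma outlier_loss:
  fixes X Y :: "real^'r^'n"
  shows "(\<Sum>x\<leftarrow>os. norm (x v* Y)) - (\<Sum>x\<leftarrow>os. norm (x v* X))
      \<le> real (length os) * c_O_max TYPE('r) os * norm (X - Y)"
proof -
  have "(\<Sum>x\<leftarrow>os. norm (x v* Y)) \<le> (\<Sum>x\<leftarrow>os. norm (x v* X) + norm (x v* (X - Y)))"
    by (intro sum_list_mono) (simp add: vector_matrix_mult_diff_rdistrib, norm)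
  then show ?thesis
    using c_O_max_bound[where os = os and B = "X - Y"] by (simp add: sum_list_addf)
qed

section \<open>Weak sharp minima\<close>

theorem proposition4:
  fixes S :: "(real^'n) set" and d :: nat
    and ys os zs :: "(real^'n) list"
    and Sperp :: "real^'r^'n"
    and \<X> :: "(real^'r^'n) set"
    and \<alpha> :: real
  assumes "subspace S" and "dim S = d"
    and "CARD('r) = CARD('n) - d"
    and "CARD('l::finite) = min d CARD('r)"
    and "span (set ys) = S"
    and "mset zs = mset ys + mset os"
    and "Sperp \<in> stiefel" and "col_space Sperp = orthogonal_comp S"
    and "\<X> = {Sperp ** R | R :: real^'r^'r. R \<in> stiefel}"
    and "real (length os) * c_O_max TYPE('r) os < 1/2 * (real (length ys) * c_Y_min TYPE('l) S ys)"
    and "\<alpha> = 1 / real (length zs) *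
           (1/2 * (real (length ys) * c_Y_min TYPE('l) S ys) - real (length os) * c_O_max TYPE('r) os)"
  shows "weak_sharp_minima (objective zs) \<X> \<alpha> stiefel \<and>
         (\<forall>X\<in>stiefel. objective zs X - objective zs Sperp \<ge> \<alpha> * infdist X \<X>)"
proof -
  define cY where "cY = real (length ys) * c_Y_min TYPE('l) S ys"
  define cO where "cO = real (length os) * c_O_max TYPE('r) os"
  define m where "m = real (length zs)"
  have cO: "0 \<le> cO" and gap: "cO < cY / 2"
    using assms(10) c_O_max_nonneg[of os, where 'r = 'r] by (simp_all add: cO_def cY_def)
  have "length zs = length ys + length os"
    using arg_cong[OF assms(6), of size] by simp
  \<comment> \<open>Without inliers \<open>cY\<close> would be zero and could not exceed \<open>2 cO \<ge> 0\<close>.\<close>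
  moreover have "ys \<noteq> []"
    using cO gap by (auto simp: cY_def)
  ultimately have m: "m > 0" by (cases ys) (auto simp: m_def)
  have \<alpha>: "\<alpha> = (cY / 2 - cO) / m"
    using assms(11) by (simp add: cY_def cO_def m_def)
  have \<alpha>_pos: "\<alpha> > 0" using gap m by (simp add: \<alpha>)

  have const: "objective zs (Sperp ** R) = objective zs Sperp" if "R \<in> stiefel" for R :: "real^'r^'r"
    by (simp add: objective_def norm_vec_mult_stiefel[OF that])

  have growth: "\<alpha> * infdist X \<X> \<le> objective zs X - objective zs Sperp" if X: "X \<in> stiefel" for X
  proof -
    obtain R where R: "R \<in> stiefel"
      and near: "(norm (X - Sperp ** R))\<^sup>2 \<le> 2 * (norm (X - Sperp ** (transpose Sperp ** X)))\<^sup>2"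
      using stiefel_nearest_basis[OF X assms(7)] by blast
    define Y where "Y = Sperp ** R"
    define t where "t = norm (X - Y)"
    define p where "p = norm (X - Sperp ** (transpose Sperp ** X))"
    have "t\<^sup>2 \<le> 2 * p\<^sup>2"
      using near by (simp add: t_def p_def Y_def)
    also have "\<dots> \<le> (2 * p)\<^sup>2"
      by (simp add: power_mult_distrib)
    finally have tp: "t \<le> 2 * p"
      by (rule power2_le_imp_le) (simp add: p_def)
    have inl: "cY * p \<le> (\<Sum>y\<leftarrow>ys. norm (y v* X))"
      using inlier_growth[where 'l = 'l, OF assms(1) _ assms(7,8), of ys X] assms(2,4,5) span_superset[of "set ys"]
      by (simp add: cY_def p_def)
    have "y v* Y = 0" if "y \<in> set ys" for y
    proof -
      have "y \<in> orthogonal_comp (col_space Sperp)"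
        unfolding assms(8) using that assms(5) span_superset[of "set ys"] orthogonal_comp_subset[of S]
        by blast
      then have "y v* Sperp = 0" by (simp add: orthogonal_comp_col_space)
      then show ?thesis by (simp add: Y_def flip: vector_matrix_mul_assoc)
    qed
    then have "map (\<lambda>y. norm (y v* Y)) ys = map (\<lambda>_. 0) ys" by simp
    then have inlY: "(\<Sum>y\<leftarrow>ys. norm (y v* Y)) = 0"
      by (simp only: sum_list_0)
    have out: "(\<Sum>x\<leftarrow>os. norm (x v* Y)) - (\<Sum>x\<leftarrow>os. norm (x v* X)) \<le> cO * t"
      unfolding cO_def t_def by (rule outlier_loss)
    have "Y \<in> \<X>" using R assms(9) by (auto simp: Y_def)
    then have "infdist X \<X> \<le> t"
      by (metis infdist_le dist_norm t_def)
    then have "\<alpha> * infdist X \<X> \<le> \<alpha> * t" using \<alpha>_pos by simp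
    also have "\<dots> = (cY * (t / 2) - cO * t) / m"
      by (simp add: \<alpha> algebra_simps)
    \<comment> \<open>This step needs \<open>cY \<ge> 0\<close>, which follows from \<open>0 \<le> cO < cY / 2\<close>.\<close>
    also have "\<dots> \<le> (cY * p - cO * t) / m"
      using tp cO gap m by (intro divide_right_mono diff_right_mono mult_left_mono) auto
    also have "\<dots> \<le> ((\<Sum>z\<leftarrow>zs. norm (z v* X)) - (\<Sum>z\<leftarrow>zs. norm (z v* Y))) / m"
      using inl inlY out m unfolding sum_list_map_mset_union[OF assms(6)]
      by (intro divide_right_mono) auto
    also have "\<dots> = objective zs X - objective zs Y"
      by (simp add: objective_def m_def diff_divide_distrib)
    finally show ?thesis
      using const[OF R] by (simp add: Y_def)
  qed

  have "\<X> \<subseteq> stiefel"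
    using assms(7) unfolding assms(9) stiefel_def
    by (auto simp: matrix_transpose_mul) (metis matrix_mul_assoc matrix_mul_lid)
  then show ?thesis
    using \<alpha>_pos growth const unfolding weak_sharp_minima_def assms(9) by auto
qed

end
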